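(* There exists a function $f:\mathbb{R}^2\to\mathbb{R}$ that is differentiable at every point of $\mathbb{R}^2$ and whose gradient is nowhere zero, such that $\{x\in\mathbb{R}^2:f(x)=0\}\cup\{\infty\}$ is a Jordan curve in $\mathbb{S}^2=\mathbb{R}^2\cup\{\infty\}$, but the level set $\{f=0\}$ is not a differentiable curve of non-zero derivative: there is no continuous injective map $\varphi:I\to\mathbb{R}^2$, with $I\subset\mathbb{R}$ an open interval and $\varphi(I)=\{f=0\}$, that is differentiable with $\varphi'(t)\neq (0,0)$ at every $t\in I$.
   Context: $\mathbb{S}^2=\mathbb{R}^2\cup\{\infty\}$ is the one-point compactification of the plane. A Jordan curve in $\mathbb{S}^2$ is the image of a continuous injective map from a circle to $\mathbb{S}^2$. Differentiable means (Fréchet) differentiable at every point; the derivative is not assumed continuous. *)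

theory Defs
  imports "HOL-Analysis.Analysis"
begin

(* The point at infinity is None; a point x of the plane is embedded as Some x. *)
abbreviation S2 :: "(real^2) option topology" where
  "S2 \<equiv> Alexandroff_compactification (euclidean :: (real^2) topology)"

definition Jordan_curve_in :: "'a topology \<Rightarrow> 'a set \<Rightarrow> bool" where
  "Jordan_curve_in X C \<longleftrightarrow>
     (\<exists>g. continuous_map (top_of_set (sphere (0::real^2) 1)) X g \<and>
          inj_on g (sphere 0 1) \<and> g ` sphere 0 1 = C)"

end

theory Submission
  imports Defs
begin

text \<open>
  Take f(x,y) = p(x) + y^2 (x - sin (1/y^2)) - y, where p is a continuously differentiable
  staircase: nondecreasing, with the sign of x, with p'(0) = 0, and constant on intervals [a, 2a]
  for arbitrarily small a > 0.  Off the x-axis the partial derivative in x is at least y^2; on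
  the x-axis the partial derivative in y is -1.  Hence the gradient never vanishes, and the zero
  set is the graph x = G(y) of a continuous function.  For y close to c = p(a) and x in [a, 2a]
  the equation f = 0 reads x = (y - c)/y^2 + sin (1/y^2), so that as y increases along
  [c, c + c^2] the abscissa G(y) drops from above 2a to below a.  The curve thus moves back
  towards the origin by a factor 2 at arbitrarily small scales, whereas under a parametrization
  with non-zero derivative at the origin the distance to the origin would be asymptotically
  proportional to the parameter.
\<close>

section \<open>Properly embedded lines as Jordan curves through infinity\<close>

text \<open>A circle minus a point is homeomorphic to the real line; following this by
  \<open>\<psi>\<close> and sending the removed point to infinity parametrizes the curve. Properness
  gives continuity at the removed point.\<close>

lemma Jordan_curve_in_S2_proper_line:
  fixes \<psi> :: "real \<Rightarrow> real^2"
  assumes cont: "continuous_on UNIV \<psi>" and inj: "inj \<psi>"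
    and proper: "\<And>K. compact K \<Longrightarrow> compact (\<psi> -` K)"
  shows "Jordan_curve_in S2 (insert None (Some ` range \<psi>))"
proof -
  define N :: "real^2" where "N = axis 1 1"
  have N: "N \<in> sphere 0 1"
    by (simp add: N_def)
  have "rel_frontier (cball (0::real^2) 1) - {N} homeomorphic (UNIV :: real set)"
    by (rule homeomorphic_punctured_sphere_affine_gen) (use N in \<open>simp_all add: rel_frontier_cball aff_dim_cball\<close>)
  then have "sphere 0 1 - {N} homeomorphic (UNIV :: real set)"
    by (simp add: rel_frontier_cball)
  then obtain \<sigma> \<tau> where \<sigma>\<tau>: "homeomorphism (sphere 0 1 - {N}) (UNIV :: real set) \<sigma> \<tau>"
    unfolding homeomorphic_def by blast
  define g where "g u = (if u = N then None else Some (\<psi> (\<sigma> u)))" for u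
  have contc: "continuous_on (sphere 0 1 - {N}) (\<lambda>u. \<psi> (\<sigma> u))"
    using continuous_on_compose2[OF cont, of "sphere 0 1 - {N}" \<sigma>] \<sigma>\<tau>
    by (auto simp: homeomorphism_def)
  have "continuous_map (top_of_set (sphere 0 1)) S2 g"
    unfolding continuous_map_def
  proof (intro conjI allI impI)
    show "g \<in> topspace (top_of_set (sphere 0 1)) \<rightarrow> topspace S2"
      by (auto simp: g_def)
    fix U assume "openin S2 U"
    then consider V where "open V" "U = Some ` V"
      | K where "compact K" "U = insert None (Some ` (UNIV - K))"
      by (auto simp: openin_Alexandroff_compactification)
    then show "openin (top_of_set (sphere 0 1)) {u \<in> topspace (top_of_set (sphere 0 1)). g u \<in> U}"
    proof cases
      case 1
      have "openin (top_of_set (sphere 0 1 - {N}))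
          ((sphere 0 1 - {N}) \<inter> (\<lambda>u. \<psi> (\<sigma> u)) -` V)"
        using contc \<open>open V\<close> by (simp add: continuous_on_open_gen continuous_openin_preimage_gen)
      moreover have "openin (top_of_set (sphere 0 1)) (sphere 0 1 - {N})"
        by (simp add: openin_delete)
      ultimately have "openin (top_of_set (sphere 0 1))
          ((sphere 0 1 - {N}) \<inter> (\<lambda>u. \<psi> (\<sigma> u)) -` V)"
        using openin_trans by blast
      moreover have "{u \<in> topspace (top_of_set (sphere 0 1)). g u \<in> U}
          = (sphere 0 1 - {N}) \<inter> (\<lambda>u. \<psi> (\<sigma> u)) -` V"
        using 1 by (auto simp: g_def)
      ultimately show ?thesis by simp
    next
      case 2
      \<comment> \<open>\<open>U\<close> is the complement of the compact set \<open>K\<close>, so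
        its preimage is the circle minus this compact, hence closed, set.\<close>
      have "compact (\<tau> ` (\<psi> -` K))"
        using proper[OF \<open>compact K\<close>] \<sigma>\<tau>
        by (meson compact_continuous_image continuous_on_subset homeomorphism_cont2 subset_UNIV)
      then have "closed (\<tau> ` (\<psi> -` K))"
        by (rule compact_imp_closed)
      moreover have "{u \<in> topspace (top_of_set (sphere 0 1)). g u \<in> U}
          = sphere 0 1 \<inter> - (\<tau> ` (\<psi> -` K))"
      proof -
        have \<tau>: "\<tau> r \<noteq> N" "\<sigma> (\<tau> r) = r" for r
          using \<sigma>\<tau> unfolding homeomorphism_def by auto
        have "\<tau> (\<sigma> u) = u" if "u \<in> sphere 0 1" "u \<noteq> N" for u
          using \<sigma>\<tau> that by (auto simp: homeomorphism_def)
        then have "u \<in> \<tau> ` (\<psi> -` K) \<longleftrightarrow> u \<noteq> N \<and> \<psi> (\<sigma> u) \<in> K" if "u \<in> sphere 0 1" for u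
          using \<tau> that by (metis image_iff vimage_eq)
        then show ?thesis
          using 2 by (auto simp: g_def)
      qed
      ultimately show ?thesis
        by (simp add: openin_open_Int open_Compl)
    qed
  qed
  moreover have "inj_on g (sphere 0 1)"
  proof (rule inj_onI)
    fix u v assume uv: "u \<in> sphere 0 1" "v \<in> sphere 0 1" "g u = g v"
    show "u = v"
    proof (cases "u = N \<or> v = N")
      case True
      with uv show ?thesis by (auto simp: g_def split: if_splits)
    next
      case False
      with uv have "\<sigma> u = \<sigma> v"
        using inj by (auto simp: g_def dest: injD)
      with False uv show ?thesis
        using \<sigma>\<tau> unfolding homeomorphism_def by (metis Diff_iff empty_iff insert_iff)
    qed
  qed
  moreover have "g ` sphere 0 1 = insert None (Some ` range \<psi>)"
  proof -
    have "g ` sphere 0 1 = insert (g N) (g ` (sphere 0 1 - {N}))"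
      using N by auto
    also have "g ` (sphere 0 1 - {N}) = Some ` \<psi> ` \<sigma> ` (sphere 0 1 - {N})"
      by (force simp: g_def)
    also have "\<sigma> ` (sphere 0 1 - {N}) = UNIV"
      using \<sigma>\<tau> by (simp add: homeomorphism_def)
    finally show ?thesis by (simp add: g_def)
  qed
  ultimately show ?thesis
    unfolding Jordan_curve_in_def by blast
qed

section \<open>A staircase with flat steps at arbitrarily small scales\<close>

text \<open>\<open>p\<close> integrates a continuous nonnegative density with both bumps and gaps at
  arbitrarily small scales: the bumps give \<open>p\<close> the sign of \<open>x\<close>, the gaps
  give the flat steps.\<close>

lemma exists_staircase:
  obtains p p' :: "real \<Rightarrow> real"
  where "\<And>x. (p has_real_derivative p' x) (at x)" "\<And>x. 0 \<le> p' x" "p 0 = 0" "p' 0 = 0"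
    "\<And>x. 0 < x \<Longrightarrow> 0 < p x" "\<And>x. x < 0 \<Longrightarrow> p x < 0"
    "\<And>\<epsilon>. \<epsilon> > 0 \<Longrightarrow> \<exists>a. 0 < a \<and> a < \<epsilon> \<and> p (2 * a) = p a"
proof -
  \<comment> \<open>The bumps are periodic in \<open>ln \<bar>t\<bar>\<close>. The factor
    \<open>\<bar>t\<bar>\<close> gives continuity at 0 and makes \<open>h 0 = 0\<close> whatever the
    value of \<open>ln 0\<close>.\<close>
  define h :: "real \<Rightarrow> real" where "h t = \<bar>t\<bar> * max 0 (sin (ln \<bar>t\<bar>))" for t
  have h_nonneg: "0 \<le> h t" for t
    by (simp add: h_def)
  have h_cont: "isCont h t" for t
  proof (cases "t = 0")
    case True
    have "(h \<longlongrightarrow> 0) (at 0)"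
    proof (rule Lim_null_comparison)
      show "\<forall>\<^sub>F t in at 0. norm (h t) \<le> \<bar>t\<bar>"
        by (simp add: h_def abs_mult mult_left_le)
    qed (auto intro!: tendsto_eq_intros)
    then show ?thesis
      using True by (simp add: isCont_def h_def)
  next
    case False
    then show ?thesis
      unfolding h_def by (intro continuous_intros) auto
  qed
  obtain P where P: "\<And>x. (P has_vector_derivative h x) (at x)"
    using einterval_antiderivative[of "-\<infinity>" "\<infinity>" h] h_cont by auto
  define p where "p x = P x - P 0" for x
  have p_DERIV: "(p has_real_derivative h x) (at x)" for x
    using P[of x] unfolding p_def has_real_derivative_iff_has_vector_derivative
    by (auto intro!: derivative_eq_intros)
  have p_mono: "p x \<le> p y" if "x \<le> y" for x y
    using DERIV_nonneg_imp_nondecreasing[OF that] p_DERIV h_nonneg by blast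
  have p_0: "p 0 = 0"
    by (simp add: p_def)
  have small: "\<exists>n::nat. exp (s - 2 * pi * real n) < \<epsilon>" if "\<epsilon> > 0" for \<epsilon> s
  proof -
    obtain n :: nat where "(s - ln \<epsilon>) / (2 * pi) < real n"
      using reals_Archimedean2 by blast
    then have "s - 2 * pi * real n < ln \<epsilon>"
      by (simp add: field_simps)
    then show ?thesis
      using that by (metis exp_less_mono exp_ln)
  qed
  have sin_shift: "sin (s - 2 * pi * real n) = sin s" for s n
    using cos_2npi[of n] sin_2npi[of n] by (simp add: sin_diff mult_ac)
  have rise: "\<exists>t>0. t < \<epsilon> \<and> 0 < h t \<and> 0 < h (- t)" if "\<epsilon> > 0" for \<epsilon>
  proof -
    \<comment> \<open>Phase \<open>pi / 2\<close> is where the sine is 1; as \<open>h\<close> is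
      even, one point serves both sides of 0.\<close>
    obtain n where "exp (pi / 2 - 2 * pi * real n) < \<epsilon>"
      using small \<open>\<epsilon> > 0\<close> by blast
    then show ?thesis
      by (intro exI[of _ "exp (pi / 2 - 2 * pi * real n)"]) (simp add: h_def sin_shift)
  qed
  have p_pos: "0 < p x" if "0 < x" for x
  proof -
    obtain t where t: "0 < t" "t < x" "0 < h t"
      using rise[OF \<open>0 < x\<close>] by blast
    \<comment> \<open>A positive derivative at \<open>t\<close> makes \<open>p\<close> increase
      strictly somewhere between 0 and \<open>x\<close>; monotonicity carries this to the endpoints.
      Capping the step by \<open>t\<close> keeps the left point nonnegative.\<close>
    obtain d where d: "d > 0" "\<And>k. k > 0 \<Longrightarrow> k < d \<Longrightarrow> p (t - k) < p t"
      using DERIV_pos_inc_left[OF p_DERIV \<open>0 < h t\<close>] by blast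
    have "p (t - min t (d / 2)) < p t"
      using t d by (intro d(2)) auto
    moreover have "p 0 \<le> p (t - min t (d / 2))" "p t \<le> p x"
      using t by (auto intro!: p_mono)
    ultimately show ?thesis
      using p_0 by linarith
  qed
  have p_neg: "p x < 0" if "x < 0" for x
  proof -
    obtain t where t: "0 < t" "t < - x" "0 < h (- t)"
      using rise[of "- x"] \<open>x < 0\<close> by auto
    obtain d where d: "d > 0" "\<And>k. k > 0 \<Longrightarrow> k < d \<Longrightarrow> p (- t) < p (- t + k)"
      using DERIV_pos_inc_right[OF p_DERIV \<open>0 < h (- t)\<close>] by blast
    have "p (- t) < p (- t + min t (d / 2))"
      using t d by (intro d(2)) auto
    moreover have "p (- t + min t (d / 2)) \<le> p 0" "p x \<le> p (- t)"
      using t by (auto intro!: p_mono)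
    ultimately show ?thesis
      using p_0 by linarith
  qed
  have flat: "\<exists>a. 0 < a \<and> a < \<epsilon> \<and> p (2 * a) = p a" if "\<epsilon> > 0" for \<epsilon>
  proof -
    obtain n where n: "exp (pi - 2 * pi * real n) < \<epsilon>"
      using small \<open>\<epsilon> > 0\<close> by blast
    \<comment> \<open>On \<open>[a, 2a]\<close> the phase \<open>ln t\<close> runs, modulo
      \<open>2 * pi\<close>, from \<open>pi\<close> to \<open>pi + ln 2\<close>. There the sine is
      nonpositive since \<open>ln 2 < pi\<close>, so \<open>h\<close> vanishes.\<close>
    define a where "a = exp (pi - 2 * pi * real n)"
    have a: "a > 0"
      by (simp add: a_def)
    have "h t = 0" if "a \<le> t" "t \<le> 2 * a" for t
    proof -
      define s where "s = ln t - ln a"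
      have "0 \<le> s" "s \<le> ln 2"
        using that a ln_mono[of t "2 * a"] by (auto simp: s_def ln_mult)
      then have "0 \<le> sin s"
        using ln_2_less_1 pi_gt3 by (intro sin_ge_zero) auto
      moreover have "ln t = (s + pi) - 2 * pi * real n"
        by (simp add: s_def a_def)
      then have "sin (ln t) = - sin s"
        by (simp only: sin_shift sin_periodic_pi)
      ultimately show ?thesis
        using that a by (simp add: h_def)
    qed
    then have "(p has_real_derivative 0) (at t)" if "a < t" "t < 2 * a" for t
      using p_DERIV[of t] that by simp
    moreover have "continuous_on {a..2 * a} p"
      using p_DERIV by (meson DERIV_isCont continuous_at_imp_continuous_on)
    ultimately have "p (2 * a) = p a"
      using a by (intro DERIV_isconst2[of a "2 * a" p]) auto
    then show ?thesis
      using a n a_def by blast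
  qed
  show ?thesis
    by (rule that[OF p_DERIV h_nonneg p_0 _ p_pos p_neg flat]) (simp_all add: h_def)
qed

section \<open>The oscillating term\<close>

text \<open>A classical differentiable function whose derivative is discontinuous at 0. There the
  factor \<open>y\<^sup>2\<close> absorbs the value of \<open>1 / 0\<close>.\<close>

definition wiggle :: "real \<Rightarrow> real"
  where "wiggle y = y + y\<^sup>2 * sin (1 / y\<^sup>2)"

text \<open>At 0 the difference quotient is \<open>1 + h * sin (1 / h\<^sup>2)\<close>, which tends
  to 1. Only this value of the derivative is recorded, because off the x-axis the partial derivative
  in x already keeps the gradient away from zero.\<close>

lemma wiggle_DERIV:
  obtains W where "\<And>y. (wiggle has_real_derivative W y) (at y)" "W 0 = 1"
proof -
  have "\<exists>D. (wiggle has_real_derivative D) (at y) \<and> (y = 0 \<longrightarrow> D = 1)" for y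
  proof (cases "y = 0")
    case True
    have "((\<lambda>h::real. h * sin (1 / h\<^sup>2)) \<longlongrightarrow> 0) (at 0)"
    proof (rule Lim_null_comparison)
      show "\<forall>\<^sub>F h::real in at 0. norm (h * sin (1 / h\<^sup>2)) \<le> \<bar>h\<bar>"
        by (simp add: abs_mult mult_left_le)
    qed (auto intro!: tendsto_eq_intros)
    then have "((\<lambda>h::real. 1 + h * sin (1 / h\<^sup>2)) \<longlongrightarrow> 1) (at 0)"
      using tendsto_add[OF tendsto_const, of _ 0 "at 0" "1::real"] by simp
    then have "((\<lambda>h. (wiggle (0 + h) - wiggle 0) / h) \<longlongrightarrow> 1) (at 0)"
      by (rule Lim_transform_eventually)
         (auto simp: wiggle_def eventually_at_filter field_simps power2_eq_square)
    then show ?thesis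
      using True by (auto simp: DERIV_def)
  next
    case False
    then have "(\<lambda>y. y + y\<^sup>2 * sin (1 / y\<^sup>2)) field_differentiable (at y)"
      by (intro field_differentiable_add field_differentiable_mult field_differentiable_ident
          field_differentiable_power field_differentiable_divide field_differentiable_const
          field_differentiable_compose[of "\<lambda>y. 1 / y\<^sup>2" _ sin, unfolded o_def]
          field_differentiable_at_sin) auto
    then show ?thesis
      using False by (auto simp: field_differentiable_def wiggle_def [abs_def])
  qed
  then show ?thesis using that by metis
qed

text \<open>Across \<open>[c, c + c\<^sup>2]\<close> the quantity \<open>1 / y\<^sup>2\<close> falls
  by about \<open>2 / c\<close>, enough for the sine to pass through 1 and later through -1.\<close>

lemma sin_inverse_square_extremes:
  fixes c :: real
  assumes "0 < c" "c < 1 / 15"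
  obtains y1 y2 where "c \<le> y1" "y1 < y2" "y2 \<le> c + c\<^sup>2"
    "sin (1 / y1\<^sup>2) = 1" "sin (1 / y2\<^sup>2) = -1"
proof -
  \<comment> \<open>The smallest value of \<open>1 / y\<^sup>2\<close> on the interval. The margin
    15 leaves room for the \<open>9 / 2 * pi\<close> used below.\<close>
  define A where "A = 1 / (c + c\<^sup>2)\<^sup>2"
  have A: "A > 0" "A + 15 \<le> 1 / c\<^sup>2"
  proof -
    have "15 * c * (1 + c)\<^sup>2 \<le> 1 * 2"
      using assms power_mono[of "1 + c" "16 / 15" 2]
      by (intro mult_mono) (auto simp: power2_eq_square)
    then have "c * (15 * c * (1 + c)\<^sup>2) \<le> c * (2 + c)"
      using assms by (intro mult_left_mono) auto
    then have main: "1 + 15 * (c + c\<^sup>2)\<^sup>2 \<le> (1 + c)\<^sup>2"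
      by (simp add: power2_eq_square algebra_simps)
    have sq: "(c + c\<^sup>2)\<^sup>2 = c\<^sup>2 * (1 + c)\<^sup>2"
      by (simp add: power2_eq_square algebra_simps)
    have "(c + c\<^sup>2)\<^sup>2 > 0"
      using assms by (intro zero_less_power add_pos_pos) auto
    then have "1 / (c + c\<^sup>2)\<^sup>2 + 15 = (1 + 15 * (c + c\<^sup>2)\<^sup>2) / (c + c\<^sup>2)\<^sup>2"
      by (simp add: add_divide_distrib)
    also have "\<dots> \<le> (1 + c)\<^sup>2 / (c + c\<^sup>2)\<^sup>2"
      using main by (intro divide_right_mono) auto
    also have "\<dots> = 1 / c\<^sup>2"
      unfolding sq using assms by simp
    finally show "A + 15 \<le> 1 / c\<^sup>2"
      by (simp add: A_def)
    show "A > 0"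
      unfolding A_def using assms by (intro divide_pos_pos zero_less_power add_pos_pos) auto
  qed
  \<comment> \<open>Rounding up costs less than \<open>2 * pi\<close>, so \<open>u1\<close> stays
    below \<open>A + 9 / 2 * pi\<close>. The maximum \<open>u1\<close> is taken after the minimum
    \<open>u2\<close>, because \<open>y = 1 / sqrt u\<close> reverses the order.\<close>
  define n where "n = \<lceil>A / (2 * pi)\<rceil>"
  define u2 u1 where "u2 = 3 / 2 * pi + 2 * pi * of_int n"
    and "u1 = pi / 2 + 2 * pi * of_int (n + 1)"
  have "A / (2 * pi) \<le> of_int n" "of_int n < A / (2 * pi) + 1"
    unfolding n_def by linarith+
  then have "A \<le> 2 * pi * of_int n" "2 * pi * of_int n < A + 2 * pi"
    by (auto simp: field_simps)
  moreover have "u1 = 2 * pi * of_int n + 5 / 2 * pi"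
    by (simp add: u1_def algebra_simps)
  moreover have "0 < pi" "9 / 2 * pi \<le> 15"
    using pi_approx by simp_all
  ultimately have u: "A \<le> u2" "u2 < u1" "u1 \<le> 1 / c\<^sup>2"
    using A(2) unfolding u2_def by linarith+
  have s1: "sin u1 = 1"
    unfolding u1_def sin_eq_1 by (rule exI[of _ "n + 1"]) (simp add: algebra_simps)
  have s2: "sin u2 = -1"
    unfolding u2_def sin_eq_minus1 by (rule exI[of _ n]) (simp add: algebra_simps)
  show ?thesis
  proof
    have "sqrt u1 \<le> sqrt (1 / c\<^sup>2)"
      using u by (intro real_sqrt_le_mono)
    then show "c \<le> 1 / sqrt u1"
      using assms u A by (simp add: real_sqrt_divide field_simps)
    show "1 / sqrt u1 < 1 / sqrt u2"
      using u A by (simp add: frac_less2)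
    show "1 / sqrt u2 \<le> c + c\<^sup>2"
    proof -
      have c2: "0 < c + c\<^sup>2"
        using assms by (simp add: add_pos_pos)
      have "1 / sqrt u2 \<le> 1 / sqrt A"
        using u A by (intro frac_le) auto
      also have "\<dots> = c + c\<^sup>2"
        using c2 by (simp add: A_def real_sqrt_divide)
      finally show ?thesis .
    qed
  qed (use u A s1 s2 in \<open>auto simp: power_divide\<close>)
qed

section \<open>The zero set as the graph of a continuous function\<close>

locale staircase =
  fixes p p' :: "real \<Rightarrow> real"
  assumes p_DERIV: "\<And>x. (p has_real_derivative p' x) (at x)"
    and p'_nonneg: "\<And>x. 0 \<le> p' x"
    and p_0: "p 0 = 0" and p'_0: "p' 0 = 0"
    and p_pos: "\<And>x. 0 < x \<Longrightarrow> 0 < p x"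
    and p_neg: "\<And>x. x < 0 \<Longrightarrow> p x < 0"
    and p_flat: "\<And>\<epsilon>. \<epsilon> > 0 \<Longrightarrow> \<exists>a. 0 < a \<and> a < \<epsilon> \<and> p (2 * a) = p a"
begin

text \<open>The function f of the construction, with the terms free of x collected in
  \<open>wiggle\<close>.\<close>

definition F :: "real \<Rightarrow> real \<Rightarrow> real"
  where "F x y = p x + y\<^sup>2 * x - wiggle y"

lemma p_mono: "x \<le> x' \<Longrightarrow> p x \<le> p x'"
  using p_DERIV p'_nonneg by (meson DERIV_nonneg_imp_nondecreasing)

lemma isCont_p [continuous_intros]: "isCont p x"
  using p_DERIV DERIV_isCont by blast

lemma isCont_wiggle: "isCont wiggle y"
  using wiggle_DERIV DERIV_isCont by metis

lemma F_strict_mono: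
  assumes "y \<noteq> 0" "x < x'"
  shows "F x y < F x' y"
proof -
  have "y\<^sup>2 * x < y\<^sup>2 * x'"
    using assms by (intro mult_strict_left_mono) auto
  then show ?thesis
    using p_mono[of x x'] assms unfolding F_def by linarith
qed

text \<open>On the x-axis \<open>F\<close> reduces to \<open>p\<close>, which has the sign of
  \<open>x\<close>; off it, \<open>F\<close> is strictly increasing in \<open>x\<close>. Recording
  the signs on both sides of the root turns bounds on the root into inequalities for
  \<open>F\<close>.\<close>

lemma F_root: "\<exists>x. F x y = 0 \<and> (\<forall>x'<x. F x' y < 0) \<and> (\<forall>x'>x. 0 < F x' y)"
proof (cases "y = 0")
  case True
  then show ?thesis
    using p_0 p_pos p_neg by (intro exI[of _ 0]) (auto simp: F_def wiggle_def)
next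
  case False
  \<comment> \<open>With this \<open>b\<close> the linear term at \<open>b\<close> and
    \<open>-b\<close> balances \<open>wiggle y\<close>, and the sign of \<open>p\<close> does the
    rest.\<close>
  define b where "b = \<bar>wiggle y\<bar> / y\<^sup>2"
  have b: "0 \<le> b" "y\<^sup>2 * b = \<bar>wiggle y\<bar>"
    using False by (auto simp: b_def)
  have "F (-b) y \<le> 0" "0 \<le> F b y"
    using b p_mono[of 0 b] p_mono[of "-b" 0] p_0 by (auto simp: F_def)
  moreover have "\<forall>x. -b \<le> x \<and> x \<le> b \<longrightarrow> isCont (\<lambda>x. F x y) x"
    unfolding F_def by (intro allI impI continuous_intros)
  ultimately obtain x where "F x y = 0"
    using IVT[of "\<lambda>x. F x y" "-b" 0 b] b by auto
  then show ?thesis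
    using F_strict_mono[OF False] by metis
qed

definition G :: "real \<Rightarrow> real"
  where "G y = (SOME x. F x y = 0 \<and> (\<forall>x'<x. F x' y < 0) \<and> (\<forall>x'>x. 0 < F x' y))"

lemma
  shows F_G: "F (G y) y = 0"
    and F_neg: "x < G y \<Longrightarrow> F x y < 0"
    and F_pos: "G y < x \<Longrightarrow> 0 < F x y"
  using someI_ex[OF F_root, of y] unfolding G_def by blast+

lemma F_eq_0_iff: "F x y = 0 \<longleftrightarrow> x = G y"
  using F_G F_neg F_pos by (metis less_irrefl linorder_neqE_linordered_idom)

lemma F_less_0_iff: "F x y < 0 \<longleftrightarrow> x < G y"
  using F_G F_neg F_pos by (metis less_asym linorder_neqE_linordered_idom)

lemma F_gt_0_iff: "0 < F x y \<longleftrightarrow> G y < x"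
  using F_G F_neg F_pos by (metis less_asym linorder_neqE_linordered_idom)

text \<open>For fixed \<open>l\<close>, both \<open>l < G y\<close> and \<open>G y < l\<close> are
  strict sign conditions on \<open>F l y\<close>, which is continuous in \<open>y\<close>; such
  conditions persist near \<open>y0\<close>.\<close>

lemma continuous_on_G: "continuous_on UNIV G"
proof -
  have F: "((\<lambda>y. F x y) \<longlongrightarrow> F x y0) (at y0)" for x y0
    using isCont_wiggle unfolding F_def isCont_def by (intro tendsto_intros)
  have "(G \<longlongrightarrow> G y0) (at y0)" for y0
  proof (rule order_tendstoI)
    fix l assume "l < G y0"
    then show "\<forall>\<^sub>F y in at y0. l < G y"
      using order_tendstoD(2)[OF F, of l y0 0] by (simp add: F_less_0_iff)
  next
    fix l assume "G y0 < l"
    then show "\<forall>\<^sub>F y in at y0. G y < l"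
      using order_tendstoD(1)[OF F, of 0 l y0] by (simp add: F_gt_0_iff)
  qed
  then show ?thesis
    by (simp add: continuous_on_def)
qed

lemma F_has_derivative:
  obtains W where "W 0 = 1"
    "\<And>z::real^2. ((\<lambda>z. F (z$1) (z$2)) has_derivative
       (\<lambda>h. (p' (z$1) + (z$2)\<^sup>2) * h$1 + (2 * z$1 * z$2 - W (z$2)) * h$2)) (at z)"
proof -
  obtain W where W: "\<And>y. (wiggle has_real_derivative W y) (at y)" "W 0 = 1"
    using wiggle_DERIV by blast
  have nth: "((\<lambda>z::real^2. z$i) has_derivative (\<lambda>h. h$i)) (at z)" for i z
    by (rule bounded_linear_imp_has_derivative) (rule bounded_linear_vec_nth)
  have "((\<lambda>z. F (z$1) (z$2)) has_derivative
       (\<lambda>h. (p' (z$1) + (z$2)\<^sup>2) * h$1 + (2 * z$1 * z$2 - W (z$2)) * h$2)) (at z)" for z :: "real^2"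
    unfolding F_def
    by (rule derivative_eq_intros nth DERIV_compose_FDERIV[OF p_DERIV]
          DERIV_compose_FDERIV[OF W(1)] refl)+ (auto simp: algebra_simps)
  with W that show ?thesis by blast
qed

section \<open>Backtracking of the graph near the origin\<close>

lemma G_pos:
  assumes "0 < y" "y < 1"
  shows "0 < G y"
proof -
  have "y\<^sup>2 * sin (1 / y\<^sup>2) \<ge> y\<^sup>2 * (- 1)"
    by (intro mult_left_mono) auto
  moreover have "y * y < y * 1"
    using assms by (intro mult_strict_left_mono) auto
  ultimately have "F 0 y < 0"
    by (simp add: F_def wiggle_def p_0 power2_eq_square)
  then show ?thesis
    by (simp add: F_less_0_iff)
qed

text \<open>With \<open>c = p a = p (2 * a)\<close>, the sine value 1 at \<open>y1 \<ge> c\<close>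
  makes \<open>F (2 * a) y1\<close> negative, and the value -1 at
  \<open>y2 \<le> c + c\<^sup>2\<close> makes \<open>F a y2\<close> positive.\<close>

lemma G_oscillates:
  assumes "0 < \<eta>"
  obtains a y1 y2 where "0 < a" "0 < y1" "y1 < y2" "y2 < \<eta>" "2 * a < G y1" "0 < G y2" "G y2 < a"
proof -
  \<comment> \<open>The bound \<open>\<eta> / 2\<close> on \<open>c\<close> gives
    \<open>y2 \<le> c + c\<^sup>2 < 2 * c < \<eta>\<close>; the bound \<open>1 / 15\<close> is the
    range in which the sine extremes exist.\<close>
  define \<delta> where "\<delta> = min (\<eta> / 2) (1 / 15)"
  have "\<delta> > 0" using assms by (simp add: \<delta>_def)
  have "(p \<longlongrightarrow> 0) (at 0)"
    using isCont_p[of 0] by (simp add: isCont_def p_0)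
  then have "\<forall>\<^sub>F x in at 0. p x < \<delta>"
    using \<open>\<delta> > 0\<close> order_tendstoD(2) by blast
  then obtain \<epsilon> where \<epsilon>: "\<epsilon> > 0" "\<And>x. x \<noteq> 0 \<Longrightarrow> \<bar>x\<bar> < \<epsilon> \<Longrightarrow> p x < \<delta>"
    unfolding eventually_at by (auto simp: dist_real_def)
  \<comment> \<open>The bound \<open>1 / 2\<close> puts \<open>2 * a\<close> below the sine value
    1.\<close>
  obtain a where a: "0 < a" "a < min \<epsilon> (1 / 2)" "p (2 * a) = p a"
    using p_flat[of "min \<epsilon> (1 / 2)"] \<epsilon>(1) by auto
  define c where "c = p a"
  have c: "0 < c" "c < \<delta>"
    using p_pos a \<epsilon>(2)[of a] by (auto simp: c_def)
  then have c': "c < 1 / 15" "c < \<eta> / 2"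
    by (auto simp: \<delta>_def)
  obtain y1 y2 where y: "c \<le> y1" "y1 < y2" "y2 \<le> c + c\<^sup>2"
    "sin (1 / y1\<^sup>2) = 1" "sin (1 / y2\<^sup>2) = -1"
    using sin_inverse_square_extremes[OF c(1) c'(1)] by blast
  have "c\<^sup>2 < c"
    using c c' by (simp add: power2_eq_square)
  have "y1\<^sup>2 * (2 * a) < y1\<^sup>2 * 1"
    using a y c by (intro mult_strict_left_mono) auto
  then have 1: "F (2 * a) y1 < 0"
    using y a by (simp add: F_def wiggle_def c_def)
  have "c\<^sup>2 \<le> y2\<^sup>2" "0 < y2\<^sup>2 * a"
    using y c a by (auto intro: power_mono)
  then have 2: "0 < F a y2"
    using y by (simp add: F_def wiggle_def c_def)
  show ?thesis
    by (rule that[of a y1 y2])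
      (use 1 2 y a c c' \<open>c\<^sup>2 < c\<close> in \<open>auto simp: F_less_0_iff F_gt_0_iff intro!: G_pos\<close>)
qed

section \<open>No parametrization with non-zero derivative\<close>

text \<open>A regular parametrization would have a horizontal velocity at the origin, making the
  abscissa asymptotically linear in the parameter. Its ordinate is monotone near \<open>t0\<close>,
  so it meets the heights \<open>y1\<close> and \<open>y2\<close> in this order and inherits the
  backtracking of \<open>G\<close>.\<close>

lemma no_regular_parametrization:
  fixes \<phi> :: "real \<Rightarrow> real^2"
  assumes I: "open I" "is_interval I" and cont: "continuous_on I \<phi>" and inj: "inj_on \<phi> I"
    and img: "\<phi> ` I = {z. F (z$1) (z$2) = 0}"
    and reg: "\<And>t. t \<in> I \<Longrightarrow> \<exists>v. (\<phi> has_vector_derivative v) (at t) \<and> v \<noteq> 0"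
  shows False
proof -
  have G0: "G 0 = 0"
    using F_eq_0_iff[of 0 0] by (simp add: F_def wiggle_def p_0)
  have \<phi>: "\<phi> t $ 1 = G (\<phi> t $ 2)" if "t \<in> I" for t
    using img that by (auto simp: F_eq_0_iff)
  have "(0::real^2) \<in> \<phi> ` I"
    unfolding img by (simp add: F_eq_0_iff G0)
  then obtain t0 where t0: "t0 \<in> I" "\<phi> t0 = 0"
    by (metis imageE)
  obtain v where v: "(\<phi> has_vector_derivative v) (at t0)" "v \<noteq> 0"
    using reg t0 by blast
  have v': "(\<phi> has_derivative (\<lambda>s. s *\<^sub>R v)) (at t0)"
    using v by (simp add: has_vector_derivative_def)
  obtain W where W: "W 0 = 1" "\<And>z::real^2. ((\<lambda>z. F (z$1) (z$2)) has_derivative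
       (\<lambda>h. (p' (z$1) + (z$2)\<^sup>2) * h$1 + (2 * z$1 * z$2 - W (z$2)) * h$2)) (at z)"
    using F_has_derivative by blast
  \<comment> \<open>The gradient at the origin is (0, -1). Since \<open>F\<close> vanishes along the
    curve, this forces the second component of \<open>v\<close> to be 0.\<close>
  have "((\<lambda>z::real^2. F (z$1) (z$2)) has_derivative (\<lambda>h. - h$2)) (at (\<phi> t0))"
    using W(2)[of 0] by (simp add: t0 W p'_0)
  from has_derivative_compose[OF v' this]
  have "((\<lambda>t. F (\<phi> t $ 1) (\<phi> t $ 2)) has_derivative (\<lambda>s. - (s * v$2))) (at t0)"
    by simp
  moreover have "((\<lambda>t. F (\<phi> t $ 1) (\<phi> t $ 2)) has_derivative (\<lambda>s. 0)) (at t0)"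
  proof (rule has_derivative_transform_within_open[OF has_derivative_const \<open>open I\<close> t0(1)])
    show "0 = F (\<phi> t $ 1) (\<phi> t $ 2)" if "t \<in> I" for t
      using \<phi>[OF that] by (simp add: F_G)
  qed
  ultimately have "(\<lambda>s. - (s * v$2)) = (\<lambda>s. 0)"
    by (rule has_derivative_unique)
  then have "v$2 = 0"
    by (metis mult_1 neg_equal_0_iff_equal)
  with v have v1: "v$1 \<noteq> 0"
    by (auto simp: vec_eq_iff forall_2)
  have "((\<lambda>t. \<phi> t $ 1) has_derivative (\<lambda>s. s * v$1)) (at t0)"
    using bounded_linear.has_derivative[OF bounded_linear_vec_nth v'] by simp
  then obtain d where d: "d > 0"
    "\<And>t. \<bar>t - t0\<bar> < d \<Longrightarrow> \<bar>\<phi> t $ 1 - (t - t0) * v$1\<bar> \<le> \<bar>v$1\<bar> / 3 * \<bar>t - t0\<bar>"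
    using v1 unfolding has_derivative_at_alt
    by (elim conjE allE[of _ "\<bar>v$1\<bar> / 3"]) (auto simp: t0)
  \<comment> \<open>With relative error 1/3, moving away from t0 shrinks the abscissa at most by a factor 2.\<close>
  have near: "2 / 3 * (\<bar>v$1\<bar> * \<bar>t - t0\<bar>) \<le> \<bar>\<phi> t $ 1\<bar>" "\<bar>\<phi> t $ 1\<bar> \<le> 4 / 3 * (\<bar>v$1\<bar> * \<bar>t - t0\<bar>)"
    if "\<bar>t - t0\<bar> < d" for t
  proof -
    have "\<bar>(t - t0) * v$1\<bar> = \<bar>v$1\<bar> * \<bar>t - t0\<bar>" "\<bar>v$1\<bar> / 3 * \<bar>t - t0\<bar> = \<bar>v$1\<bar> * \<bar>t - t0\<bar> / 3"
      by (simp_all add: abs_mult mult.commute)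
    then show "2 / 3 * (\<bar>v$1\<bar> * \<bar>t - t0\<bar>) \<le> \<bar>\<phi> t $ 1\<bar>"
      and "\<bar>\<phi> t $ 1\<bar> \<le> 4 / 3 * (\<bar>v$1\<bar> * \<bar>t - t0\<bar>)"
      using d(2)[OF that] by linarith+
  qed
  obtain e where e: "e > 0" "cball t0 e \<subseteq> I"
    using open_contains_cball t0(1) \<open>open I\<close> by blast
  define r where "r = min e (d / 2)"
  have "cball t0 r \<subseteq> I"
    using e by (intro subset_trans[OF subset_cball e(2)]) (simp add: r_def)
  then have r: "r > 0" "r < d" "{t0 - r..t0 + r} \<subseteq> I"
    using e(1) d(1) by (auto simp: r_def cball_eq_atLeastAtMost)
  define Y where "Y t = \<phi> t $ 2" for t
  have Ycont: "continuous_on S Y" if "S \<subseteq> {t0 - r..t0 + r}" for S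
    unfolding Y_def using continuous_on_subset[OF cont] that r(3) by (intro continuous_intros) auto
  \<comment> \<open>On the zero set the ordinate determines the abscissa through \<open>G\<close>,
    so injectivity passes to the ordinate, which is then strictly monotone across
    \<open>t0\<close>.\<close>
  have "inj_on Y I"
  proof (rule inj_onI)
    fix s t assume "s \<in> I" "t \<in> I" "Y s = Y t"
    then have "\<phi> s = \<phi> t"
      using \<phi> by (simp add: vec_eq_iff forall_2 Y_def)
    then show "s = t"
      using inj \<open>s \<in> I\<close> \<open>t \<in> I\<close> by (meson inj_onD)
  qed
  then have "inj_on Y {t0 - r..t0 + r}"
    using r(3) inj_on_subset by blast
  then have "(Y (t0 - r) < Y t0 \<and> Y t0 < Y (t0 + r)) \<or> (Y (t0 + r) < Y t0 \<and> Y t0 < Y (t0 - r))"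
    using r by (intro continuous_inj_imp_mono Ycont) auto
  \<comment> \<open>Exactly one end of the parameter interval lies at positive height; which one
    depends on the orientation of \<open>\<phi>\<close>.\<close>
  then obtain \<eta> where \<eta>: "\<eta> > 0" "\<eta> = Y (t0 + r) \<or> \<eta> = Y (t0 - r)"
    by (auto simp: Y_def t0)
  obtain a y1 y2 where osc: "0 < a" "0 < y1" "y1 < y2" "y2 < \<eta>"
    "2 * a < G y1" "0 < G y2" "G y2 < a"
    using G_oscillates[OF \<eta>(1)] by blast
  have Y0: "Y t0 = 0"
    by (simp add: Y_def t0)
  \<comment> \<open>The height \<open>y2\<close> is reached on the positive side, and the lower
    height \<open>y1\<close> between \<open>t0\<close> and that parameter.\<close>
  obtain s t where st: "\<bar>t - t0\<bar> \<le> \<bar>s - t0\<bar>" "\<bar>s - t0\<bar> \<le> r" "Y s = y2" "Y t = y1"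
    using \<eta>(2)
  proof
    assume h: "\<eta> = Y (t0 + r)"
    obtain s where s: "t0 \<le> s" "s \<le> t0 + r" "Y s = y2"
      using IVT'[of Y t0 y2 "t0 + r"] Ycont[of "{t0..t0 + r}"] Y0 osc h r by auto
    obtain t where t: "t0 \<le> t" "t \<le> s" "Y t = y1"
      using IVT'[of Y t0 y1 s] Ycont[of "{t0..s}"] Y0 osc s r by auto
    show ?thesis
      using that[of t s] s t by auto
  next
    assume h: "\<eta> = Y (t0 - r)"
    obtain s where s: "t0 - r \<le> s" "s \<le> t0" "Y s = y2"
      using IVT2'[of Y t0 y2 "t0 - r"] Ycont[of "{t0 - r..t0}"] Y0 osc h r by auto
    obtain t where t: "s \<le> t" "t \<le> t0" "Y t = y1"
      using IVT2'[of Y t0 y1 s] Ycont[of "{s..t0}"] Y0 osc s r by auto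
    show ?thesis
      using that[of t s] s t by auto
  qed
  have "s \<in> {t0 - r..t0 + r}" "t \<in> {t0 - r..t0 + r}"
    using st(1,2) by (simp_all add: abs_le_iff) linarith+
  then have mem: "s \<in> I" "t \<in> I"
    using r(3) by blast+
  have "2 * a < \<phi> t $ 1" "0 < \<phi> s $ 1" "\<phi> s $ 1 < a"
    using \<phi>[OF mem(1)] \<phi>[OF mem(2)] osc st by (auto simp: Y_def)
  moreover have "\<bar>v$1\<bar> * \<bar>t - t0\<bar> \<le> \<bar>v$1\<bar> * \<bar>s - t0\<bar>"
    using st(1) by (intro mult_left_mono) auto
  \<comment> \<open>The abscissa at \<open>t\<close> exceeds \<open>2 * a\<close> but is at most
    \<open>4 / 3 * (\<bar>v$1\<bar> * \<bar>s - t0\<bar>)\<close>, hence at most twice the abscissa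
    at \<open>s\<close>, which is below \<open>a\<close>.\<close>
  ultimately show False
    using near(2)[of t] near(1)[of s] st(1,2) r(2) by linarith
qed

section \<open>The Jordan curve and the non-vanishing gradient\<close>

text \<open>The graph is parametrized by its ordinate. This is proper because the preimage of
  \<open>K\<close> lies in the bounded projection of \<open>K\<close>.\<close>

lemma zero_set_Jordan_curve:
  "Jordan_curve_in S2 (insert None (Some ` {z. F (z$1) (z$2) = 0}))"
proof -
  define \<psi> :: "real \<Rightarrow> real^2" where "\<psi> y = vector [G y, y]" for y
  have nth: "\<psi> y $ 1 = G y" "\<psi> y $ 2 = y" for y
    by (simp_all add: \<psi>_def)
  have range: "range \<psi> = {z. F (z$1) (z$2) = 0}"
  proof (intro equalityI subsetI)
    fix z :: "real^2" assume "z \<in> {z. F (z$1) (z$2) = 0}"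
    then have "z = \<psi> (z$2)"
      by (simp add: vec_eq_iff forall_2 nth F_eq_0_iff)
    then show "z \<in> range \<psi>" by blast
  qed (auto simp: nth F_G)
  have "\<psi> = (\<lambda>y. \<chi> i. if i = 1 then G y else y)"
    by (auto simp: fun_eq_iff vec_eq_iff forall_2 nth)
  moreover have "continuous_on UNIV (\<lambda>y. if i = 1 then G y else y)" for i :: 2
    using continuous_on_G by (cases "i = 1") auto
  ultimately have cont: "continuous_on UNIV \<psi>"
    by (simp add: continuous_on_vec_lambda)
  have "Jordan_curve_in S2 (insert None (Some ` range \<psi>))"
  proof (rule Jordan_curve_in_S2_proper_line[OF cont])
    show "inj \<psi>"
      using nth(2) by (metis injI)
    fix K :: "(real^2) set" assume K: "compact K"
    have "bounded ((\<lambda>z. z$2) ` K)"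
      using K compact_imp_bounded bounded_component_cart by blast
    moreover have "\<psi> -` K \<subseteq> (\<lambda>z. z$2) ` K"
      using nth(2) by (metis image_eqI subsetI vimageD)
    ultimately have "bounded (\<psi> -` K)"
      using bounded_subset by blast
    moreover have "closed (\<psi> -` K)"
      using cont K by (simp add: closed_vimage compact_imp_closed continuous_on_eq_continuous_at)
    ultimately show "compact (\<psi> -` K)"
      by (simp add: compact_eq_bounded_closed)
  qed
  then show ?thesis
    by (simp add: range)
qed

end

theorem mainTheorem3:
  shows "\<exists>f :: real^2 \<Rightarrow> real.
    (\<forall>x. f differentiable (at x)) \<and>
    (\<forall>x D. GDERIV f x :> D \<longrightarrow> D \<noteq> 0) \<and>
    Jordan_curve_in S2 (insert None (Some ` {x. f x = 0})) \<and>
    \<not> (\<exists>(\<phi> :: real \<Rightarrow> real^2) I.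
         open I \<and> is_interval I \<and>
         continuous_on I \<phi> \<and> inj_on \<phi> I \<and> \<phi> ` I = {x. f x = 0} \<and>
         (\<forall>t\<in>I. \<exists>v. (\<phi> has_vector_derivative v) (at t) \<and> v \<noteq> 0))"
proof -
  obtain p p' where "staircase p p'"
    using exists_staircase unfolding staircase_def by metis
  then interpret staircase p p' .
  obtain W where W: "W 0 = 1" "\<And>z::real^2. ((\<lambda>z. F (z$1) (z$2)) has_derivative
       (\<lambda>h. (p' (z$1) + (z$2)\<^sup>2) * h$1 + (2 * z$1 * z$2 - W (z$2)) * h$2)) (at z)"
    using F_has_derivative by blast
  have "D \<noteq> 0" if "GDERIV (\<lambda>z. F (z$1) (z$2)) z :> D" for z D :: "real^2"
  proof
    assume "D = 0"
    with that have "((\<lambda>z. F (z$1) (z$2)) has_derivative (\<lambda>h. 0)) (at z)"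
      by (simp add: gderiv_def)
    from has_derivative_unique[OF W(2) this]
    have *: "(p' (z$1) + (z$2)\<^sup>2) * h$1 + (2 * z$1 * z$2 - W (z$2)) * h$2 = 0" for h :: "real^2"
      by meson
    \<comment> \<open>Both summands of the first coefficient are nonnegative, so
      \<open>z$2 = 0\<close>; the second coefficient is then \<open>- W 0 = -1\<close>.\<close>
    have "p' (z$1) + (z$2)\<^sup>2 = 0" "2 * z$1 * z$2 - W (z$2) = 0"
      using *[of "axis 1 1"] *[of "axis 2 1"] by (simp_all add: axis_def)
    with p'_nonneg[of "z$1"] W(1) show False
      by (simp add: add_nonneg_eq_0_iff)
  qed
  then show ?thesis
    using W(2) zero_set_Jordan_curve no_regular_parametrization
    by (intro exI[of _ "\<lambda>z. F (z$1) (z$2)"]) (auto simp: differentiable_def, metis+)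
qed

end
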